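(* Let $n\ge1$ be an integer and $\alpha>0$. There is no nonnegative function $u\in C^3(\mathbb{R}^n)$ that satisfies $$\sum_{i,j=1}^n\Bigl(\delta_{ij}-\frac{u_iu_j}{1+|\nabla u|^2}\Bigr)u_{ij}=\Bigl(\frac{1}{\sqrt{1+|\nabla u|^2}}\Bigr)^{\alpha-1}\quad\text{for all }x\in\mathbb{R}^n$$ and $$\lim_{|x|\to\infty}\frac{|u(x)|}{|x|}=0.$$
   Context: Subscripts denote partial derivatives: $u_i=\partial u/\partial x_i$, $u_{ij}=\partial^2u/\partial x_i\partial x_j$. *)

theory Defs
  imports "HOL-Analysis.Analysis"
begin

definition partial :: "'n::finite \<Rightarrow> (real^'n \<Rightarrow> real) \<Rightarrow> real^'n \<Rightarrow> real" where
  "partial i f x = deriv (\<lambda>t. f (x + t *\<^sub>R axis i 1)) 0"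

definition grad :: "(real^'n::finite \<Rightarrow> real) \<Rightarrow> real^'n \<Rightarrow> real^'n" where
  "grad f x = (\<chi> i. partial i f x)"

(* Differentiability is explicit in the step because deriv also has a (junk) value
   where no derivative exists.  It is Frechet differentiability; this agrees with
   the definition by existence and continuity of all partial derivatives of order
   at most k, since continuous first partials imply Frechet differentiability. *)
primrec C_k :: "nat \<Rightarrow> (real^'n::finite \<Rightarrow> real) \<Rightarrow> bool" where
  "C_k 0 f \<longleftrightarrow> continuous_on UNIV f"
| "C_k (Suc k) f \<longleftrightarrow> f differentiable_on UNIV \<and> (\<forall>i. C_k k (partial i f))"

end

theory Submission
  imports Defs
begin

text \<open>Touch \<open>u\<close> from above by a shallow paraboloid: since \<open>u\<close> grows at most linearly,
  \<open>u - \<epsilon> |x|\<^sup>2\<close> attains its maximum at some \<open>z\<close>. There the gradient of \<open>u\<close> is \<open>2 \<epsilon> z\<close>, which stays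
  bounded as \<open>\<epsilon> \<rightarrow> 0\<close>, and the Hessian of \<open>u\<close> is at most \<open>2 \<epsilon> I\<close>. So the left-hand side of
  the equation at \<open>z\<close> is at most \<open>2 \<epsilon> n\<close>, while the right-hand side is bounded below by a
  positive constant independent of \<open>\<epsilon>\<close>.\<close>

text \<open>\<open>partial\<close> is a bare \<open>deriv\<close>, so differentiability is what
  makes it the true directional derivative along \<open>axis i 1\<close>; linearity then determines
  the derivative on every vector.\<close>

lemma has_derivative_partial:
  fixes f :: "real^'n::finite \<Rightarrow> real"
  assumes "f differentiable (at x)"
  shows "(f has_derivative (\<lambda>h. \<Sum>i\<in>UNIV. h $ i * partial i f x)) (at x)"
proof -
  obtain D where D: "(f has_derivative D) (at x)"
    using assms unfolding differentiable_def by blast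
  interpret D: bounded_linear D by (rule has_derivative_bounded_linear[OF D])
  have axis: "D (axis i 1) = partial i f x" for i
  proof -
    have "((\<lambda>t. x + t *\<^sub>R axis i 1) has_derivative (\<lambda>t. t *\<^sub>R axis i 1)) (at 0)"
      by (auto intro!: derivative_eq_intros)
    then have "((\<lambda>t. f (x + t *\<^sub>R axis i 1)) has_derivative (\<lambda>t. D (t *\<^sub>R axis i 1))) (at 0)"
      by (rule has_derivative_compose) (use D in simp)
    moreover have "(\<lambda>t. D (t *\<^sub>R axis i 1)) = (*) (D (axis i 1))"
      by (auto simp: D.scaleR)
    ultimately have "((\<lambda>t. f (x + t *\<^sub>R axis i 1)) has_field_derivative D (axis i 1)) (at 0)"
      by (simp add: has_field_derivative_def)
    then show ?thesis unfolding partial_def by (simp add: DERIV_imp_deriv)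
  qed
  have "D h = (\<Sum>i\<in>UNIV. h $ i * partial i f x)" for h
  proof -
    have "D h = D (\<Sum>i\<in>UNIV. h $ i *\<^sub>R axis i 1)"
      by (simp add: basis_expansion flip: scalar_mult_eq_scaleR)
    then show ?thesis by (simp add: D.sum D.scaleR axis)
  qed
  then have "D = (\<lambda>h. \<Sum>i\<in>UNIV. h $ i * partial i f x)" by blast
  with D show ?thesis by simp
qed

text \<open>Chain rule along a line. Applied to \<open>u\<close> and then to each
  \<open>partial j u\<close>, it gives the first and second derivatives of \<open>u\<close> in any
  direction.\<close>

lemma has_real_derivative_along_line:
  fixes f :: "real^'n::finite \<Rightarrow> real"
  assumes "f differentiable_on UNIV"
  shows "((\<lambda>t. f (x + t *\<^sub>R v)) has_real_derivative
           (\<Sum>i\<in>UNIV. v $ i * partial i f (x + t *\<^sub>R v))) (at t)"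
proof -
  have "f differentiable (at (x + t *\<^sub>R v))"
    using assms by (simp add: differentiable_on_def)
  note D = has_derivative_partial[OF this]
  have "((\<lambda>t. x + t *\<^sub>R v) has_derivative (\<lambda>t. t *\<^sub>R v)) (at t)"
    by (auto intro!: derivative_eq_intros)
  note has_derivative_compose[OF this D]
  moreover have "(\<lambda>s. \<Sum>i\<in>UNIV. (s *\<^sub>R v) $ i * partial i f (x + t *\<^sub>R v))
      = (*) (\<Sum>i\<in>UNIV. v $ i * partial i f (x + t *\<^sub>R v))"
    by (auto simp: sum_distrib_left mult_ac)
  ultimately show ?thesis by (simp add: has_field_derivative_def)
qed

text \<open>If \<open>D\<close> were positive, \<open>g'\<close> would be positive just to the right
  of its zero \<open>a\<close>, and \<open>g\<close> would increase strictly past its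
  maximum.\<close>

lemma second_derivative_nonpos_at_max:
  fixes g g' :: "real \<Rightarrow> real"
  assumes g: "\<And>t. (g has_real_derivative g' t) (at t)"
    and g': "(g' has_real_derivative D) (at a)"
    and max: "\<And>t. g t \<le> g a"
  shows "g' a = 0" "D \<le> 0"
proof -
  show crit: "g' a = 0"
    by (rule DERIV_local_max[OF g zero_less_one]) (use max in auto)
  show "D \<le> 0"
  proof (rule ccontr)
    assume "\<not> D \<le> 0"
    with DERIV_pos_inc_right[OF g'] obtain d where d: "d > 0" "\<And>h. 0 < h \<Longrightarrow> h < d \<Longrightarrow> g' a < g' (a + h)"
      by auto
    have "g a < g (a + d/2)"
    proof (rule DERIV_pos_imp_increasing_open[of a "a + d/2" g])
      fix x assume "a < x" "x < a + d/2"
      then have "g' x > 0" using d(2)[of "x - a"] crit d(1) by auto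
      then show "\<exists>y. (g has_real_derivative y) (at x) \<and> y > 0" using g by blast
    qed (use d g in \<open>auto intro!: continuous_at_imp_continuous_on DERIV_isCont\<close>)
    with max show False by (simp add: not_le[symmetric])
  qed
qed

text \<open>On every line through \<open>z\<close> the difference of \<open>u\<close> and the
  paraboloid is maximal at \<open>z\<close>, so the one-variable test applies. Coordinate directions
  yield the gradient, arbitrary \<open>v\<close> the Hessian bound as a quadratic form.\<close>

lemma touched_by_paraboloid:
  fixes u :: "real^'n::finite \<Rightarrow> real"
  assumes u: "C_k 2 u" and max: "\<And>x. u x - e * (norm x)\<^sup>2 \<le> u z - e * (norm z)\<^sup>2"
  shows "partial i u z = 2 * e * z $ i"
    and "(\<Sum>i\<in>UNIV. \<Sum>j\<in>UNIV. v $ i * v $ j * partial i (partial j u) z) \<le> 2 * e * (norm v)\<^sup>2"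
proof -
  have u1: "u differentiable_on UNIV" and u2: "partial j u differentiable_on UNIV" for j
    using u by (simp_all add: numeral_2_eq_2)
  define q where "q v t = (norm (z + t *\<^sub>R v))\<^sup>2" for v t
  have q: "q v t = (norm z)\<^sup>2 + 2 * t * (z \<bullet> v) + t\<^sup>2 * (norm v)\<^sup>2" for v t
    unfolding q_def power2_norm_eq_inner
    by (simp only: inner_simps) (simp add: inner_commute algebra_simps power2_eq_square)
  define g where "g v t = u (z + t *\<^sub>R v) - e * q v t" for v t
  define g' where "g' v t = (\<Sum>j\<in>UNIV. v $ j * partial j u (z + t *\<^sub>R v))
      - e * (2 * (z \<bullet> v) + 2 * t * (norm v)\<^sup>2)" for v t
  have g: "(g v has_real_derivative g' v t) (at t)" for v t
    unfolding g_def g'_def q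
    by (auto intro!: derivative_eq_intros has_real_derivative_along_line[OF u1])
  have g2: "(g' v has_real_derivative
      (\<Sum>j\<in>UNIV. v $ j * (\<Sum>i\<in>UNIV. v $ i * partial i (partial j u) z))
        - 2 * e * (norm v)\<^sup>2) (at 0)" for v
  proof -
    have *: "((\<lambda>t. partial j u (z + t *\<^sub>R v)) has_real_derivative
        (\<Sum>i\<in>UNIV. v $ i * partial i (partial j u) z)) (at 0)" for j
      using has_real_derivative_along_line[OF u2[of j], of z v 0] by simp
    show ?thesis
      unfolding g'_def by (auto intro!: derivative_eq_intros * simp: mult_ac)
  qed
  have "g v t \<le> g v 0" for v t
    using max[of "z + t *\<^sub>R v"] by (simp add: g_def q_def)
  then have test: "g' v 0 = 0" "(\<Sum>j\<in>UNIV. v $ j * (\<Sum>i\<in>UNIV. v $ i * partial i (partial j u) z))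
        - 2 * e * (norm v)\<^sup>2 \<le> 0" for v
    using second_derivative_nonpos_at_max[OF g g2] by blast+
  have "(\<Sum>j\<in>UNIV. axis i 1 $ j * partial j u z) = partial i u z"
    by (subst sum.remove[of _ i]) (auto simp: axis_def intro!: sum.neutral)
  then show "partial i u z = 2 * e * z $ i"
    using test(1)[of "axis i 1"] by (simp add: g'_def inner_axis)
  have "(\<Sum>i\<in>UNIV. \<Sum>j\<in>UNIV. v $ i * v $ j * partial i (partial j u) z)
      = (\<Sum>j\<in>UNIV. v $ j * (\<Sum>i\<in>UNIV. v $ i * partial i (partial j u) z))"
    by (subst sum.swap) (simp add: sum_distrib_left mult_ac)
  then show "(\<Sum>i\<in>UNIV. \<Sum>j\<in>UNIV. v $ i * v $ j * partial i (partial j u) z) \<le> 2 * e * (norm v)\<^sup>2"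
    using test(2)[of v] by simp
qed

text \<open>The coefficient matrix \<open>A\<close> is a sum of rank-one matrices b_k b_k^T, so the
  trace of \<open>A\<close> times \<open>H\<close> is the sum of the values of the form
  \<open>H\<close> at the b_k. This is at most \<open>K\<close> times the sum of |b_k|^2, which is
  the trace of \<open>A\<close>, and each diagonal entry of \<open>A\<close> is at most 1.\<close>

lemma mean_curvature_trace_le:
  fixes p :: "real^'n::finite" and H :: "'n \<Rightarrow> 'n \<Rightarrow> real"
  assumes H: "\<And>v :: real^'n. (\<Sum>i\<in>UNIV. \<Sum>j\<in>UNIV. v $ i * v $ j * H i j) \<le> K * (norm v)\<^sup>2"
    and K: "K \<ge> 0"
  shows "(\<Sum>i\<in>UNIV. \<Sum>j\<in>UNIV. ((if i = j then 1 else 0) - p $ i * p $ j / (1 + (norm p)\<^sup>2)) * H i j)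
    \<le> K * CARD('n)"
proof -
  define W where "W = sqrt (1 + (norm p)\<^sup>2)"
  have W: "W > 0" "W\<^sup>2 = 1 + (norm p)\<^sup>2" by (auto simp: W_def add_pos_nonneg)
  define A :: "'n \<Rightarrow> 'n \<Rightarrow> real"
    where "A i j = (if i = j then 1 else 0) - p $ i * p $ j / (1 + (norm p)\<^sup>2)" for i j
  \<comment> \<open>The \<open>b k\<close> are the columns of the positive square root \<open>I - c p p\<^sup>T\<close> of \<open>A\<close>.\<close>
  define c where "c = 1 / (W * (W + 1))"
  define b where "b k = axis k 1 - (c * p $ k) *\<^sub>R p" for k
  have pp: "(\<Sum>k\<in>UNIV. p $ k * p $ k) = (norm p)\<^sup>2"
    by (simp add: power2_norm_eq_inner inner_vec_def)
  \<comment> \<open>This identity makes the square of I - c p p^T equal to \<open>A\<close>. The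
    value of \<open>c\<close> comes from the eigenvalue along \<open>p\<close>: it is 1/W^2 for
    \<open>A\<close>, so the root needs 1 - c |p|^2 = 1/W.\<close>
  have c: "2 * c - c\<^sup>2 * (norm p)\<^sup>2 = 1 / (1 + (norm p)\<^sup>2)"
  proof -
    have "(norm p)\<^sup>2 = W\<^sup>2 - 1" using W by simp
    moreover have "2 * c - c\<^sup>2 * (W\<^sup>2 - 1) = 1 / W\<^sup>2"
      using W(1) unfolding c_def
      by (simp add: divide_simps add_pos_pos) (simp add: power2_eq_square algebra_simps)
    ultimately show ?thesis by simp
  qed
  have A: "(\<Sum>k\<in>UNIV. b k $ i * b k $ j) = A i j" for i j
  proof -
    \<comment> \<open>Each Kronecker delta in \<open>k\<close> gets its own term, so that summing
      over \<open>k\<close> collapses it.\<close>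
    have "b k $ i * b k $ j = (if k = i then (if i = j then 1 else 0) - c * p $ i * p $ j else 0)
        - (if k = j then c * p $ i * p $ j else 0) + c\<^sup>2 * p $ i * p $ j * (p $ k * p $ k)" for k
      by (auto simp: b_def axis_def power2_eq_square algebra_simps)
    then have "(\<Sum>k\<in>UNIV. b k $ i * b k $ j) =
        (if i = j then 1 else 0) - c * p $ i * p $ j - c * p $ i * p $ j
          + c\<^sup>2 * p $ i * p $ j * (norm p)\<^sup>2"
      by (simp add: sum.distrib sum_subtractf pp flip: sum_distrib_left)
    also have "\<dots> = (if i = j then 1 else 0) - (p $ i * p $ j) * (2 * c - c\<^sup>2 * (norm p)\<^sup>2)"
      by (simp add: algebra_simps)
    finally show ?thesis by (simp add: c A_def)
  qed
  have "(\<Sum>i\<in>UNIV. \<Sum>j\<in>UNIV. A i j * H i j)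
      = (\<Sum>i\<in>UNIV. \<Sum>j\<in>UNIV. \<Sum>k\<in>UNIV. b k $ i * b k $ j * H i j)"
    by (simp add: sum_distrib_right flip: A)
  also have "\<dots> = (\<Sum>i\<in>UNIV. \<Sum>k\<in>UNIV. \<Sum>j\<in>UNIV. b k $ i * b k $ j * H i j)"
    by (intro sum.cong refl sum.swap)
  also have "\<dots> = (\<Sum>k\<in>UNIV. \<Sum>i\<in>UNIV. \<Sum>j\<in>UNIV. b k $ i * b k $ j * H i j)"
    by (rule sum.swap)
  also have "\<dots> \<le> (\<Sum>k\<in>UNIV. K * (norm (b k))\<^sup>2)"
    by (intro sum_mono H)
  also have "\<dots> = K * (\<Sum>k\<in>UNIV. \<Sum>i\<in>UNIV. b k $ i * b k $ i)"
    by (simp add: sum_distrib_left power2_norm_eq_inner inner_vec_def)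
  also have "\<dots> = K * (\<Sum>i\<in>UNIV. A i i)"
    by (subst sum.swap) (simp add: A)
  also have "(\<Sum>i\<in>UNIV. A i i) \<le> (\<Sum>i\<in>(UNIV :: 'n set). 1)"
    by (intro sum_mono) (simp add: A_def add_nonneg_nonneg)
  finally show ?thesis using K by (simp add: A_def mult_left_mono)
qed

text \<open>Outside a large ball the quotient is below 1; inside it, compactness bounds
  \<open>u\<close> by a constant. The sum of both bounds works everywhere.\<close>

lemma sublinear_imp_linear_bound:
  fixes u :: "'a::euclidean_space \<Rightarrow> real"
  assumes cont: "continuous_on UNIV u"
    and lim: "((\<lambda>x. \<bar>u x\<bar> / norm x) \<longlongrightarrow> 0) at_infinity"
  obtains C where "C \<ge> 0" "\<And>x. \<bar>u x\<bar> \<le> C + norm x"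
proof -
  have "\<forall>\<^sub>F x in at_infinity. \<bar>u x\<bar> / norm x < 1"
    using lim by (rule order_tendstoD) simp
  then obtain B where B: "\<And>x. norm x \<ge> B \<Longrightarrow> \<bar>u x\<bar> / norm x < 1"
    unfolding eventually_at_infinity by blast
  \<comment> \<open>With radius \<bar>B\<bar> every point outside the ball is nonzero, so the
    quotient there is not the default value of division by zero.\<close>
  have "compact (u ` cball 0 \<bar>B\<bar>)"
    by (rule compact_continuous_image) (use cont continuous_on_subset in auto)
  then obtain C where "C > 0" "\<forall>y \<in> u ` cball 0 \<bar>B\<bar>. norm y \<le> C"
    using compact_imp_bounded bounded_pos by metis
  then have C: "C > 0" "\<And>x. norm x \<le> \<bar>B\<bar> \<Longrightarrow> \<bar>u x\<bar> \<le> C" by auto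
  have "\<bar>u x\<bar> \<le> C + norm x" for x
  proof (cases "norm x \<le> \<bar>B\<bar>")
    case True
    then show ?thesis using C(2)[of x] by (simp add: add_increasing2)
  next
    case False
    then have "\<bar>u x\<bar> / norm x < 1" "norm x > 0" using B[of x] by linarith+
    then show ?thesis using C(1) by (simp add: divide_less_eq)
  qed
  with C(1) show thesis by (intro that[of C]) auto
qed

text \<open>Far out the quadratic term pushes the difference below its value at 0, so a maximum over
  a closed ball is global. The ball has radius of order 1/e, which bounds the later gradient
  \<open>2 * e * z\<close> independently of \<open>e\<close>.\<close>

lemma paraboloid_max:
  fixes u :: "'a::euclidean_space \<Rightarrow> real"
  assumes cont: "continuous_on UNIV u" and C: "C \<ge> 0" "\<And>x. \<bar>u x\<bar> \<le> C + norm x"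
    and e: "0 < e" "e \<le> 1"
  obtains z where "\<And>x. u x - e * (norm x)\<^sup>2 \<le> u z - e * (norm z)\<^sup>2" "e * norm z \<le> 2 * C + 1"
proof -
  define w where "w x = u x - e * (norm x)\<^sup>2" for x
  have upper: "w x \<le> C + norm x * (1 - e * norm x)" for x
    using C(2)[of x] by (simp add: w_def power2_eq_square algebra_simps)
  have w0: "w 0 \<ge> - C" using C(2)[of 0] by (simp add: w_def)
  \<comment> \<open>The threshold \<open>2 * C + 1\<close> makes the factor
    \<open>1 - e * norm x\<close> less than \<open>- 2 * C\<close>. As \<open>e \<le> 1\<close>
    forces \<open>norm x > 1\<close>, this gives \<open>w x < C - 2 * C \<le> w 0\<close>.\<close>
  have far: "w x < w 0" if "e * norm x > 2 * C + 1" for x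
  proof -
    have "1 < e * norm x" using that C(1) by linarith
    also have "\<dots> \<le> norm x" using e mult_right_mono[of e 1 "norm x"] by simp
    finally have "1 < norm x" .
    have "norm x * (1 - e * norm x) < norm x * (- 2 * C)"
      using that \<open>1 < norm x\<close> by (intro mult_strict_left_mono) auto
    also have "\<dots> \<le> 1 * (- 2 * C)"
      using \<open>1 < norm x\<close> C(1) by (intro mult_right_mono_neg) auto
    finally have "norm x * (1 - e * norm x) < - 2 * C" by simp
    with upper[of x] w0 show ?thesis by simp
  qed
  define r where "r = (2 * C + 1) / e"
  have r: "norm x \<le> r \<longleftrightarrow> e * norm x \<le> 2 * C + 1" for x :: 'a
    using e by (simp add: r_def field_simps)
  have "continuous_on (cball 0 r) w"
    unfolding w_def by (intro continuous_intros continuous_on_subset[OF cont]) auto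
  moreover have zero: "0 \<in> cball (0::'a) r" using e C(1) by (simp add: r_def)
  ultimately obtain z where z: "z \<in> cball 0 r" "\<And>x. x \<in> cball 0 r \<Longrightarrow> w x \<le> w z"
    using continuous_attains_sup[of "cball 0 r" w] by auto
  have "w x \<le> w z" for x
  proof (cases "norm x \<le> r")
    case False
    then have "w x < w 0" using far r by auto
    then show ?thesis using z(2)[OF zero] by simp
  qed (use z in auto)
  with z(1) r show thesis by (intro that[of z]) (auto simp: w_def)
qed

theorem theorem1p3:
  fixes \<alpha> :: real
  assumes "\<alpha> > 0"
  shows "\<not> (\<exists>u :: real^'n::finite \<Rightarrow> real.
    C_k 3 u \<and> (\<forall>x. u x \<ge> 0) \<and>
    (\<forall>x. (\<Sum>i\<in>UNIV. \<Sum>j\<in>UNIV.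
            ((if i = j then 1 else 0) - partial i u x * partial j u x / (1 + (norm (grad u x))\<^sup>2))
              * partial i (partial j u) x)
          = (1 / sqrt (1 + (norm (grad u x))\<^sup>2)) powr (\<alpha> - 1)) \<and>
    ((\<lambda>x. \<bar>u x\<bar> / norm x) \<longlongrightarrow> 0) at_infinity)"
proof (rule notI, elim exE conjE)
  fix u :: "real^'n::finite \<Rightarrow> real"
  assume u: "C_k 3 u"
    and eq: "\<forall>x. (\<Sum>i\<in>UNIV. \<Sum>j\<in>UNIV.
            ((if i = j then 1 else 0) - partial i u x * partial j u x / (1 + (norm (grad u x))\<^sup>2))
              * partial i (partial j u) x)
          = (1 / sqrt (1 + (norm (grad u x))\<^sup>2)) powr (\<alpha> - 1)"
    and lim: "((\<lambda>x. \<bar>u x\<bar> / norm x) \<longlongrightarrow> 0) at_infinity"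
  have u2: "C_k 2 u"
    using u by (auto simp: numeral_2_eq_2 numeral_3_eq_3 differentiable_imp_continuous_on)
  have cont: "continuous_on UNIV u"
    using u by (simp add: numeral_3_eq_3 differentiable_imp_continuous_on)
  obtain C where C: "C \<ge> 0" "\<And>x. \<bar>u x\<bar> \<le> C + norm x"
    using sublinear_imp_linear_bound[OF cont lim] by blast
  \<comment> \<open>\<open>M\<close> will bound the gradient at the touching point and
    \<open>m\<close> the right-hand side from below. Both depend only on \<open>C\<close> and
    \<alpha>, so \<open>e\<close> may be chosen after them.\<close>
  define M where "M = 2 * (2 * C + 1)"
  define m where "m = (1 / sqrt (1 + M\<^sup>2)) powr \<alpha>"
  have "1 + M\<^sup>2 > 0" by (simp add: add_pos_nonneg)
  then have m: "m > 0" by (simp add: m_def)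
  \<comment> \<open>This gives \<open>2 * e * CARD('n) \<le> m / 2\<close>; the cap 1 is what
    \<open>paraboloid_max\<close> requires.\<close>
  define e where "e = min 1 (m / (4 * CARD('n)))"
  have e: "0 < e" "e \<le> 1" using m by (auto simp: e_def)
  have em: "2 * e * CARD('n) < m"
  proof -
    have "e \<le> m / (4 * CARD('n))" by (simp add: e_def)
    then have "4 * (e * CARD('n)) \<le> m" by (simp add: field_simps)
    then show ?thesis using m by simp
  qed
  obtain z where max: "\<And>x. u x - e * (norm x)\<^sup>2 \<le> u z - e * (norm z)\<^sup>2"
    and ez: "e * norm z \<le> 2 * C + 1"
    using paraboloid_max[OF cont C e] by blast
  note touch = touched_by_paraboloid[OF u2 max]
  have "grad u z = (2 * e) *\<^sub>R z"
    by (simp add: vec_eq_iff grad_def touch(1))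
  then have gradM: "norm (grad u z) \<le> M"
    using e ez by (simp add: M_def)
  define s where "s = 1 / sqrt (1 + (norm (grad u z))\<^sup>2)"
  have pos: "1 + (norm (grad u z))\<^sup>2 > 0" by (simp add: add_pos_nonneg)
  have s: "0 < s" "s \<le> 1" "1 / sqrt (1 + M\<^sup>2) \<le> s"
    using pos gradM by (auto simp: s_def intro!: divide_left_mono power_mono mult_pos_pos add_pos_nonneg)
  \<comment> \<open>Passing through the positive exponent \<alpha> allows monotonicity in the base.
    Since \<open>s \<le> 1\<close>, lowering the exponent to \<alpha> - 1 only increases the power,
    whatever the sign of \<alpha> - 1.\<close>
  have "m \<le> s powr \<alpha>"
    unfolding m_def using s assms by (intro powr_mono2) auto
  also have "\<dots> \<le> s powr (\<alpha> - 1)"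
    using s by (intro powr_mono') auto
  also have "\<dots> \<le> 2 * e * CARD('n)"
    using mean_curvature_trace_le[OF touch(2), of "grad u z"] e eq[rule_format, of z]
    by (simp add: s_def grad_def)
  finally show False using em by simp
qed

end
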